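(* Let $b,d,e,y,u,w,q,t_1,t_2$ be nonzero complex numbers, let $r_i,s_i$ ($i=1,2,3$) be nonnegative real numbers, put $r=2r_1+r_2+r_3$, $s=2s_1+s_2+s_3$, and let $n\ge0$ be an integer. Assume that no denominator below vanishes. Then $$\frac1{t_1}\sum_{k=0}^{n-1}\mathcal D\bigl(et_1q^{(r_2+r_3-2r_1)(k-1)},bt_1q^{(r_3-r_2)(k-1)},dt_1q^{(r_3-r_2)(k-1)},bdet_1q^{r(k-1)+2}\bigr)q^{(r-2r_3)(k-1)+1}$$ $$\times\frac{(bq,dq;q^{2r_1})_{k-1}(eq;q^{2r_2})_{k-1}(bdet_1^2q;q^{2r_3})_{k-1}}{(deqt_1,beqt_1;q^{r-2r_1})_k(bdqt_1;q^{r-2r_2})_k(q/t_1;q^{r-2r_3})_k}\,\frac{(yq,wq;q^{2s_1})_k(uq;q^{2s_2})_k(yt_2^2wuq;q^{2s_3})_k}{(wuqt_2,yuqt_2;q^{s-2s_1})_k(ywqt_2;q^{s-2s_2})_k(q/t_2;q^{s-2s_3})_k}$$ $$=\frac{(bq,dq;q^{2r_1})_{n-1}(eq;q^{2r_2})_{n-1}(bt_1^2deq;q^{2r_3})_{n-1}}{(deqt_1,beqt_1;q^{r-2r_1})_{n-1}(bdqt_1;q^{r-2r_2})_{n-1}(q/t_1;q^{r-2r_3})_{n-1}}\,\frac{(yq,wq;q^{2s_1})_n(uq;q^{2s_2})_n(yt_2^2wuq;q^{2s_3})_n}{(wuqt_2,yuqt_2;q^{s-2s_1})_n(ywqt_2;q^{s-2s_2})_n(q/t_2;q^{s-2s_3})_n}$$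 $$-\frac{(q^{r-2r_1}-deqt_1)(q^{r-2r_1}-beqt_1)(q^{r-2r_2}-bdqt_1)(q^{r-2r_3}-q/t_1)}{(q^{2r_1}-bq)(q^{2r_1}-dq)(q^{2r_2}-eq)(q^{2r_3}-bt_1^2deq)}$$ $$-\frac1{t_2}\sum_{k=0}^{n-1}\mathcal D\bigl(yt_2q^{(s_3-s_2)k},ut_2q^{(s_2+s_3-2s_1)k},wt_2q^{(s_3-s_2)k},ywut_2q^{sk+2}\bigr)q^{(s-2s_3)k+1}$$ $$\times\frac{(yq,wq;q^{2s_1})_k(uq;q^{2s_2})_k(yt_2^2wuq;q^{2s_3})_k}{(wuqt_2,yuqt_2;q^{s-2s_1})_{k+1}(ywqt_2;q^{s-2s_2})_{k+1}(q/t_2;q^{s-2s_3})_{k+1}}\,\frac{(bq,dq;q^{2r_1})_k(eq;q^{2r_2})_k(bdeqt_1^2;q^{2r_3})_k}{(deqt_1,beqt_1;q^{r-2r_1})_k(bdqt_1;q^{r-2r_2})_k(q/t_1;q^{r-2r_3})_k}.$$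
   Context: $\mathcal D(x_1,\dots,x_m):=\prod_{i=1}^m(1-x_i)$. For a nonzero base $q$ and an integer $m\ge 0$, $(a;q)_m=\prod_{j=0}^{m-1}(1-aq^j)$, $(a;q)_{-1}=1/(1-a/q)$, and $(a_1,\dots,a_l;q)_m=\prod_{i=1}^l(a_i;q)_m$. Real powers are $q^t=\exp(t\log q)$ for a fixed choice of $\log q$. Empty sums are $0$. (The paper calls this a $(3,3)$-type transformation with degree $2m$, $m=\max\{r_i,s_i\}$.) *)

theory Defs
  imports Complex_Main
begin

definition D_prod :: "complex list \<Rightarrow> complex" where
  "D_prod xs = (\<Prod>x\<leftarrow>xs. 1 - x)"

text \<open>The index is an integer so that \<open>-1\<close> is available.  Indices below \<open>-1\<close> have no
  intended meaning (the value there is the empty product).  Since \<open>1 / 0 = 0\<close>, for \<open>p \<noteq> 0\<close>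
  the statement \<open>qpoch a p (-1) \<noteq> 0\<close> says exactly that this value is well defined, i.e. that
  \<open>1 - a / p \<noteq> 0\<close>.\<close>

definition qpoch :: "complex \<Rightarrow> complex \<Rightarrow> int \<Rightarrow> complex" where
  "qpoch a p m = (if m = -1 then 1 / (1 - a / p) else (\<Prod>j<nat m. 1 - a * p ^ j))"

definition qpochs :: "complex list \<Rightarrow> complex \<Rightarrow> int \<Rightarrow> complex" where
  "qpochs as p m = (\<Prod>a\<leftarrow>as. qpoch a p m)"

text \<open>The real power \<open>q\<^sup>t\<close> of a complex \<open>q\<close> depends on the choice of a logarithm \<open>L\<close> of \<open>q\<close>
  (any \<open>L\<close> with \<open>exp L = q\<close>), which is therefore the argument here.\<close>

definition rpow :: "complex \<Rightarrow> real \<Rightarrow> complex" where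
  "rpow L t = exp (of_real t * L)"

end

theory Submission
  imports Defs
begin

text \<open>Write the two groups of \<open>q\<close>-shifted factorials as quotients \<open>F\<close> (parameters \<open>b, d, e, t\<^sub>1, r\<^sub>i\<close>)
  and \<open>G\<close> (parameters \<open>y, w, u, t\<^sub>2, s\<^sub>i\<close>).  The factorisation
  \<open>(1 - a\<^sub>1)\<dots>(1 - a\<^sub>4) - (1 - c\<^sub>1)\<dots>(1 - c\<^sub>4)\<close> of the numerator of \<open>F (m + 1) - F m\<close> shows that the
  two summands are \<open>(F k - F (k - 1)) G k\<close> and \<open>F k (G (k + 1) - G k)\<close>.  Hence the two sums together
  telescope to \<open>F (n - 1) G n - F (-1) G 0\<close>, that is, the identity is summation by parts.\<close>

section \<open>Real powers of the base for a fixed logarithm \<open>L\<close>\<close>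

lemma rpow_nonzero [simp]: "rpow L x \<noteq> 0"
  by (simp add: rpow_def)

lemma rpow_0 [simp]: "rpow L 0 = 1"
  by (simp add: rpow_def)

lemma rpow_add: "rpow L (x + y) = rpow L x * rpow L y"
  by (simp add: rpow_def exp_add algebra_simps)

lemma rpow_diff: "rpow L (x - y) = rpow L x / rpow L y"
  by (simp add: rpow_def exp_diff algebra_simps)

lemma rpow_power: "rpow L x ^ k = rpow L (x * real k)"
  by (simp add: rpow_def exp_of_nat_mult [symmetric] mult_ac)

lemma rpow_powi: "rpow L x powi m = rpow L (x * of_int m)"
proof (cases "m \<ge> 0")
  case True
  then show ?thesis
    by (simp add: power_int_def rpow_power)
next
  case False
  then have "rpow L x powi m = inverse (rpow L (x * real (nat (- m))))"
    by (simp add: power_int_def rpow_power power_inverse)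
  also have "\<dots> = rpow L (- (x * real (nat (- m))))"
    by (simp add: rpow_def exp_minus)
  also have "\<dots> = rpow L (x * of_int m)"
    using False by simp
  finally show ?thesis .
qed

section \<open>Recurrences for shifted factorials, including the index \<open>-1\<close>\<close>

lemma qpoch_0 [simp]: "qpoch a p 0 = 1"
  by (simp add: qpoch_def)

text \<open>The value at \<open>-1\<close> is the one that extends the recurrence down by one index;
  there it is a division by \<open>1 - a / p\<close>, hence the side condition at
  \<open>m = -1\<close>.\<close>

lemma qpoch_step:
  assumes "m \<ge> -1" "m = -1 \<Longrightarrow> a \<noteq> p" "p \<noteq> 0"
  shows "qpoch a p (m + 1) = qpoch a p m * (1 - a * p powi m)"
proof (cases "m = -1")
  case True
  with assms show ?thesis
    by (simp add: qpoch_def divide_simps)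
next
  case False
  with assms have "nat (m + 1) = Suc (nat m)" "m \<ge> 0" by auto
  with False show ?thesis
    by (simp add: qpoch_def power_int_def)
qed

text \<open>At \<open>m = -1\<close> the junk value \<open>1 / 0 = 0\<close> makes this hold even when \<open>a = p\<close>.\<close>

lemma inverse_qpoch_step:
  assumes "m \<ge> -1" "p \<noteq> 0" "qpoch a p (m + 1) \<noteq> 0"
  shows "inverse (qpoch a p m) = (1 - a * p powi m) * inverse (qpoch a p (m + 1))"
proof (cases "m = -1 \<and> a = p")
  case True
  with assms show ?thesis
    by (simp add: qpoch_def)
next
  case False
  then have "qpoch a p (m + 1) = qpoch a p m * (1 - a * p powi m)"
    using assms by (intro qpoch_step) auto
  with assms show ?thesis
    by simp
qed

section \<open>Consecutive differences of the quotients \<open>qnum / qden\<close>\<close>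

definition qnum ::
  "complex \<Rightarrow> complex \<Rightarrow> complex \<Rightarrow> complex \<Rightarrow> complex \<Rightarrow> real \<Rightarrow> real \<Rightarrow> real \<Rightarrow> int \<Rightarrow> complex" where
  "qnum L b d e t r1 r2 r3 m =
    qpochs [b * exp L, d * exp L] (rpow L (2 * r1)) m * qpoch (e * exp L) (rpow L (2 * r2)) m *
    qpoch (b * d * e * t^2 * exp L) (rpow L (2 * r3)) m"

text \<open>The exponents stay unsimplified, so that replacing \<open>2 * r1 + r2 + r3\<close> by
  \<open>r\<close> gives literally \<open>r - 2 * r1\<close> and its analogues.\<close>

definition qden ::
  "complex \<Rightarrow> complex \<Rightarrow> complex \<Rightarrow> complex \<Rightarrow> complex \<Rightarrow> real \<Rightarrow> real \<Rightarrow> real \<Rightarrow> int \<Rightarrow> complex" where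
  "qden L b d e t r1 r2 r3 m =
    qpochs [d * e * exp L * t, b * e * exp L * t] (rpow L (2 * r1 + r2 + r3 - 2 * r1)) m *
    qpoch (b * d * exp L * t) (rpow L (2 * r1 + r2 + r3 - 2 * r2)) m *
    qpoch (exp L / t) (rpow L (2 * r1 + r2 + r3 - 2 * r3)) m"

lemma qnum_0 [simp]: "qnum L b d e t r1 r2 r3 0 = 1"
  by (simp add: qnum_def qpochs_def)

lemma qden_0 [simp]: "qden L b d e t r1 r2 r3 0 = 1"
  by (simp add: qden_def qpochs_def)

text \<open>Let a1, ..., a4 be the terms subtracted from 1 in the first product and c =
  \<open>q / t * (A^2 * B / C)\<close>. Then a4 = a1 a2 a3 / c^2, the other terms of the second
  product are a2 a3 / c, a1 a3 / c, a1 a2 / c, and the right side is c times the factors with terms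
  a3 / c, a1 / c, a2 / c, a1 a2 a3 / c. The difference vanishes when a1, a2 or a3 equals c and when
  a1 a2 a3 = c, which accounts for these four factors.\<close>

lemma difference_factorisation:
  fixes A B C :: complex
  assumes "A \<noteq> 0" "B \<noteq> 0" "C \<noteq> 0" "t \<noteq> 0"
  shows "(1 - b * q * A^2) * (1 - d * q * A^2) * (1 - e * q * B^2) * (1 - b * d * e * t^2 * q * C^2)
      - (1 - d * e * q * t * (B * C)) * (1 - b * e * q * t * (B * C)) *
        (1 - b * d * q * t * (A^2 * C / B)) * (1 - q / t * (A^2 * B / C))
    = 1 / t * ((1 - e * t * (B * C / A^2)) * (1 - b * t * (C / B)) * (1 - d * t * (C / B)) *
        (1 - b * d * e * t * (A^2 * B * C * q^2))) * (A^2 * B / C * q)"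
  using assms by (simp add: divide_simps) algebra

text \<open>Serves both sums: the first with \<open>m = k - 1\<close>, the second with
  \<open>m = k\<close>. Only the first reaches \<open>m = -1\<close>, where the numerator is built
  from reciprocals and \<open>start\<close> makes them well defined.\<close>

lemma quotient_difference:
  assumes m: "m \<ge> -1" and t: "t \<noteq> 0"
    and nz: "qden L b d e t r1 r2 r3 (m + 1) \<noteq> 0"
    and start: "m = -1 \<Longrightarrow>
      (rpow L (2 * r1) - b * exp L) * (rpow L (2 * r1) - d * exp L) * (rpow L (2 * r2) - e * exp L) *
      (rpow L (2 * r3) - b * t^2 * d * e * exp L) \<noteq> 0"
  shows "qnum L b d e t r1 r2 r3 (m + 1) / qden L b d e t r1 r2 r3 (m + 1)
      - qnum L b d e t r1 r2 r3 m / qden L b d e t r1 r2 r3 m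
    = 1 / t * (D_prod [e * t * rpow L ((r2 + r3 - 2 * r1) * of_int m), b * t * rpow L ((r3 - r2) * of_int m),
        d * t * rpow L ((r3 - r2) * of_int m), b * d * e * t * rpow L ((2 * r1 + r2 + r3) * of_int m + 2)] *
      rpow L ((2 * r1 + r2 + r3 - 2 * r3) * of_int m + 1) *
      (qnum L b d e t r1 r2 r3 m / qden L b d e t r1 r2 r3 (m + 1)))"
proof -
  \<comment> \<open>All powers that occur become monomials in \<open>A\<close>, \<open>B\<close>,
    \<open>C\<close>, \<open>q\<close> and their inverses, which reduces the claim to a rational
    identity.\<close>
  define q A B C where "q = exp L" and "A = rpow L (r1 * of_int m)"
    and "B = rpow L (r2 * of_int m)" and "C = rpow L (r3 * of_int m)"
  have ABC: "A \<noteq> 0" "B \<noteq> 0" "C \<noteq> 0"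
    by (auto simp: A_def B_def C_def)
  have q1: "rpow L 1 = q" and q2: "rpow L 2 = q^2"
    by (simp_all add: q_def rpow_def exp_double)
  have sq: "rpow L (2 * x * of_int m) = rpow L (x * of_int m) ^ 2" for x
    by (simp add: rpow_power mult_ac)
  have num_pows: "rpow L (2 * r1) powi m = A^2" "rpow L (2 * r2) powi m = B^2"
      "rpow L (2 * r3) powi m = C^2"
    by (simp_all add: rpow_powi sq A_def B_def C_def)
  have den_pows: "rpow L (2 * r1 + r2 + r3 - 2 * r1) powi m = B * C"
      "rpow L (2 * r1 + r2 + r3 - 2 * r2) powi m = A^2 * C / B"
      "rpow L (2 * r1 + r2 + r3 - 2 * r3) powi m = A^2 * B / C"
    unfolding rpow_powi using ABC
    by (simp_all add: A_def B_def C_def distrib_right left_diff_distrib rpow_add rpow_diff sq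
        power2_eq_square)
  have D_pows: "rpow L ((r2 + r3 - 2 * r1) * of_int m) = B * C / A^2"
      "rpow L ((r3 - r2) * of_int m) = C / B"
      "rpow L ((2 * r1 + r2 + r3) * of_int m + 2) = A^2 * B * C * q^2"
      "rpow L ((2 * r1 + r2 + r3 - 2 * r3) * of_int m + 1) = A^2 * B / C * q"
    using ABC
    by (simp_all add: A_def B_def C_def distrib_right left_diff_distrib rpow_add rpow_diff sq q1 q2
        power2_eq_square)
  have num: "qnum L b d e t r1 r2 r3 (m + 1) = qnum L b d e t r1 r2 r3 m *
      ((1 - b * q * A^2) * (1 - d * q * A^2) * (1 - e * q * B^2) * (1 - b * d * e * t^2 * q * C^2))"
  proof -
    have "m = -1 \<Longrightarrow> b * exp L \<noteq> rpow L (2 * r1)" "m = -1 \<Longrightarrow> d * exp L \<noteq> rpow L (2 * r1)"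
        "m = -1 \<Longrightarrow> e * exp L \<noteq> rpow L (2 * r2)"
        "m = -1 \<Longrightarrow> b * d * e * t^2 * exp L \<noteq> rpow L (2 * r3)"
      using start by (auto simp: mult_ac)
    then show ?thesis
      using m by (simp add: qnum_def qpochs_def qpoch_step num_pows q_def)
  qed
  \<comment> \<open>Stated for inverses because at \<open>m = -1\<close> a factor
    \<open>1 - a / p\<close> may be 0; its reciprocal then has the default value 0, and both sides
    vanish.\<close>
  have den: "inverse (qden L b d e t r1 r2 r3 m) = inverse (qden L b d e t r1 r2 r3 (m + 1)) *
      ((1 - d * e * q * t * (B * C)) * (1 - b * e * q * t * (B * C)) *
        (1 - b * d * q * t * (A^2 * C / B)) * (1 - q / t * (A^2 * B / C)))"
  proof -
    have nz': "qpoch (d * e * exp L * t) (rpow L (2 * r1 + r2 + r3 - 2 * r1)) (m + 1) \<noteq> 0"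
        "qpoch (b * e * exp L * t) (rpow L (2 * r1 + r2 + r3 - 2 * r1)) (m + 1) \<noteq> 0"
        "qpoch (b * d * exp L * t) (rpow L (2 * r1 + r2 + r3 - 2 * r2)) (m + 1) \<noteq> 0"
        "qpoch (exp L / t) (rpow L (2 * r1 + r2 + r3 - 2 * r3)) (m + 1) \<noteq> 0"
      using nz by (auto simp: qden_def qpochs_def)
    show ?thesis
      unfolding qden_def qpochs_def list.map prod_list.Cons prod_list.Nil mult_1_right
        inverse_mult_distrib nz' [THEN inverse_qpoch_step [OF m rpow_nonzero]] den_pows q_def
      by (simp only: mult_ac)
  qed
  have regroup: "N * P * I - N * (I * Q) = N * I * (P - Q)" for N P I Q :: complex
    by (simp add: algebra_simps)
  have "qnum L b d e t r1 r2 r3 (m + 1) / qden L b d e t r1 r2 r3 (m + 1)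
      - qnum L b d e t r1 r2 r3 m / qden L b d e t r1 r2 r3 m
    = qnum L b d e t r1 r2 r3 m / qden L b d e t r1 r2 r3 (m + 1) *
      ((1 - b * q * A^2) * (1 - d * q * A^2) * (1 - e * q * B^2) * (1 - b * d * e * t^2 * q * C^2)
      - (1 - d * e * q * t * (B * C)) * (1 - b * e * q * t * (B * C)) *
        (1 - b * d * q * t * (A^2 * C / B)) * (1 - q / t * (A^2 * B / C)))"
    \<comment> \<open>Restricted to quotients with numerator \<open>qnum\<close>: divisions such as
      \<open>q / t\<close> must survive to match \<open>difference_factorisation\<close>.\<close>
    unfolding divide_inverse [of "qnum L b d e t r1 r2 r3 x" for x]
    unfolding num den
    by (rule regroup)
  then show ?thesis
    unfolding difference_factorisation [OF ABC t] D_pows D_prod_def list.map prod_list.Cons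
      prod_list.Nil mult_1_right
    by (simp only: mult_ac)
qed

text \<open>Evaluates the lower boundary term of the summation by parts. Each factorial at
  \<open>-1\<close> is \<open>p / (p - a)\<close>, and the bases \<open>p\<close> cancel between
  numerator and denominator.\<close>

lemma quotient_start:
  assumes "(rpow L (2 * r1) - b * exp L) * (rpow L (2 * r1) - d * exp L) * (rpow L (2 * r2) - e * exp L) *
      (rpow L (2 * r3) - b * t^2 * d * e * exp L) \<noteq> 0"
  shows "qnum L b d e t r1 r2 r3 (-1) / qden L b d e t r1 r2 r3 (-1) =
    ((rpow L (2 * r1 + r2 + r3 - 2 * r1) - d * e * exp L * t) *
     (rpow L (2 * r1 + r2 + r3 - 2 * r1) - b * e * exp L * t) *
     (rpow L (2 * r1 + r2 + r3 - 2 * r2) - b * d * exp L * t) *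
     (rpow L (2 * r1 + r2 + r3 - 2 * r3) - exp L / t)) /
    ((rpow L (2 * r1) - b * exp L) * (rpow L (2 * r1) - d * exp L) * (rpow L (2 * r2) - e * exp L) *
     (rpow L (2 * r3) - b * t^2 * d * e * exp L))"
proof -
  have minus1: "qpoch a p (-1) = p / (p - a)" if "p \<noteq> 0" for a p
    using that by (simp add: qpoch_def divide_simps)
  \<comment> \<open>With r = \<open>2 * r1 + r2 + r3\<close>, the exponents on each side add up to 2
    r.\<close>
  have weight: "rpow L (2 * r1) * rpow L (2 * r1) * rpow L (2 * r2) * rpow L (2 * r3) =
      rpow L (2 * r1 + r2 + r3 - 2 * r1) * rpow L (2 * r1 + r2 + r3 - 2 * r1) *
      rpow L (2 * r1 + r2 + r3 - 2 * r2) * rpow L (2 * r1 + r2 + r3 - 2 * r3)"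
    by (simp add: rpow_add [symmetric] add_ac)
  \<comment> \<open>Remains true when some \<open>m1\<close>, ..., \<open>m4\<close> is 0: both
    sides are then 0, since division by 0 gives 0.\<close>
  have cancel: "(x1 / n1 * (x2 / n2) * (x3 / n3) * (x4 / n4)) / (z1 / m1 * (z2 / m2) * (z3 / m3) * (z4 / m4))
      = (m1 * m2 * m3 * m4) / (n1 * n2 * n3 * n4)"
    if "x1 * x2 * x3 * x4 = z1 * z2 * z3 * z4" "x1 * x2 * x3 * x4 \<noteq> 0"
    for x1 x2 x3 x4 n1 n2 n3 n4 z1 z2 z3 z4 m1 m2 m3 m4 :: complex
  proof -
    have "(x1 / n1 * (x2 / n2) * (x3 / n3) * (x4 / n4)) / (z1 / m1 * (z2 / m2) * (z3 / m3) * (z4 / m4))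
      = (x1 * x2 * x3 * x4) / (z1 * z2 * z3 * z4) * ((m1 * m2 * m3 * m4) / (n1 * n2 * n3 * n4))"
      by (simp add: mult_ac)
    with that show ?thesis by simp
  qed
  have "qnum L b d e t r1 r2 r3 (-1) / qden L b d e t r1 r2 r3 (-1) =
    ((rpow L (2 * r1 + r2 + r3 - 2 * r1) - d * e * exp L * t) *
     (rpow L (2 * r1 + r2 + r3 - 2 * r1) - b * e * exp L * t) *
     (rpow L (2 * r1 + r2 + r3 - 2 * r2) - b * d * exp L * t) *
     (rpow L (2 * r1 + r2 + r3 - 2 * r3) - exp L / t)) /
    ((rpow L (2 * r1) - b * exp L) * (rpow L (2 * r1) - d * exp L) * (rpow L (2 * r2) - e * exp L) *
     (rpow L (2 * r3) - b * d * e * t^2 * exp L))"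
    unfolding qnum_def qden_def qpochs_def list.map prod_list.Cons prod_list.Nil mult_1_right
      minus1 [OF rpow_nonzero]
    by (rule cancel [OF weight]) simp
  then show ?thesis
    by (simp only: mult_ac)
qed

text \<open>Integer indices make \<open>F (-1)\<close> available as lower boundary value; for
  \<open>n = 0\<close> the two boundary terms cancel.\<close>

lemma sum_by_parts_int:
  fixes F G :: "int \<Rightarrow> 'a :: comm_ring"
  shows "(\<Sum>k<n. (F (int k) - F (int k - 1)) * G (int k)) =
    F (int n - 1) * G (int n) - F (-1) * G 0 - (\<Sum>k<n. (G (int k + 1) - G (int k)) * F (int k))"
  by (induction n) (simp_all add: algebra_simps)

theorem corollary4p10:
  fixes b d e y u w q t1 t2 L :: complex
    and r1 r2 r3 s1 s2 s3 r s :: real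
    and n :: nat
  assumes nonzero: "b \<noteq> 0" "d \<noteq> 0" "e \<noteq> 0" "y \<noteq> 0" "u \<noteq> 0" "w \<noteq> 0" "q \<noteq> 0" "t1 \<noteq> 0" "t2 \<noteq> 0"
    and log_q: "exp L = q"
    and nonneg: "r1 \<ge> 0" "r2 \<ge> 0" "r3 \<ge> 0" "s1 \<ge> 0" "s2 \<ge> 0" "s3 \<ge> 0"
    and r: "r = 2 * r1 + r2 + r3"
    and s: "s = 2 * s1 + s2 + s3"
    and den_sums: "\<And>k. k < n \<Longrightarrow>
      (qpochs [d * e * q * t1, b * e * q * t1] (rpow L (r - 2 * r1)) (int k) *
       qpoch (b * d * q * t1) (rpow L (r - 2 * r2)) (int k) * qpoch (q / t1) (rpow L (r - 2 * r3)) (int k)) \<noteq> 0"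
      "\<And>k. k < n \<Longrightarrow>
      (qpochs [w * u * q * t2, y * u * q * t2] (rpow L (s - 2 * s1)) (int k) *
       qpoch (y * w * q * t2) (rpow L (s - 2 * s2)) (int k) * qpoch (q / t2) (rpow L (s - 2 * s3)) (int k)) \<noteq> 0"
    and den_rhs1:
      "(qpochs [d * e * q * t1, b * e * q * t1] (rpow L (r - 2 * r1)) (int n - 1) *
       qpoch (b * d * q * t1) (rpow L (r - 2 * r2)) (int n - 1) * qpoch (q / t1) (rpow L (r - 2 * r3)) (int n - 1)) \<noteq> 0"
      "(qpochs [w * u * q * t2, y * u * q * t2] (rpow L (s - 2 * s1)) (int n) *
       qpoch (y * w * q * t2) (rpow L (s - 2 * s2)) (int n) * qpoch (q / t2) (rpow L (s - 2 * s3)) (int n)) \<noteq> 0"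
    and den_rhs2:
      "((rpow L (2 * r1) - b * q) * (rpow L (2 * r1) - d * q) * (rpow L (2 * r2) - e * q) *
       (rpow L (2 * r3) - b * t1^2 * d * e * q)) \<noteq> 0"
    and den_sum2: "\<And>k. k < n \<Longrightarrow>
      (qpochs [w * u * q * t2, y * u * q * t2] (rpow L (s - 2 * s1)) (int k + 1) *
       qpoch (y * w * q * t2) (rpow L (s - 2 * s2)) (int k + 1) * qpoch (q / t2) (rpow L (s - 2 * s3)) (int k + 1)) \<noteq> 0"
  shows
    "1 / t1 * (\<Sum>k<n.
      D_prod [e * t1 * rpow L ((r2 + r3 - 2 * r1) * (real k - 1)), b * t1 * rpow L ((r3 - r2) * (real k - 1)),
              d * t1 * rpow L ((r3 - r2) * (real k - 1)), b * d * e * t1 * rpow L (r * (real k - 1) + 2)] *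
      rpow L ((r - 2 * r3) * (real k - 1) + 1) *
      ((qpochs [b * q, d * q] (rpow L (2 * r1)) (int k - 1) * qpoch (e * q) (rpow L (2 * r2)) (int k - 1) *
       qpoch (b * d * e * t1^2 * q) (rpow L (2 * r3)) (int k - 1)) /
      (qpochs [d * e * q * t1, b * e * q * t1] (rpow L (r - 2 * r1)) (int k) *
       qpoch (b * d * q * t1) (rpow L (r - 2 * r2)) (int k) * qpoch (q / t1) (rpow L (r - 2 * r3)) (int k))) *
      ((qpochs [y * q, w * q] (rpow L (2 * s1)) (int k) * qpoch (u * q) (rpow L (2 * s2)) (int k) *
       qpoch (y * t2^2 * w * u * q) (rpow L (2 * s3)) (int k)) /
      (qpochs [w * u * q * t2, y * u * q * t2] (rpow L (s - 2 * s1)) (int k) *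
       qpoch (y * w * q * t2) (rpow L (s - 2 * s2)) (int k) * qpoch (q / t2) (rpow L (s - 2 * s3)) (int k))))
     =
      ((qpochs [b * q, d * q] (rpow L (2 * r1)) (int n - 1) * qpoch (e * q) (rpow L (2 * r2)) (int n - 1) *
       qpoch (b * t1^2 * d * e * q) (rpow L (2 * r3)) (int n - 1)) /
      (qpochs [d * e * q * t1, b * e * q * t1] (rpow L (r - 2 * r1)) (int n - 1) *
       qpoch (b * d * q * t1) (rpow L (r - 2 * r2)) (int n - 1) * qpoch (q / t1) (rpow L (r - 2 * r3)) (int n - 1))) *
      ((qpochs [y * q, w * q] (rpow L (2 * s1)) (int n) * qpoch (u * q) (rpow L (2 * s2)) (int n) *
       qpoch (y * t2^2 * w * u * q) (rpow L (2 * s3)) (int n)) /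
      (qpochs [w * u * q * t2, y * u * q * t2] (rpow L (s - 2 * s1)) (int n) *
       qpoch (y * w * q * t2) (rpow L (s - 2 * s2)) (int n) * qpoch (q / t2) (rpow L (s - 2 * s3)) (int n)))
     - (((rpow L (r - 2 * r1) - d * e * q * t1) * (rpow L (r - 2 * r1) - b * e * q * t1) *
       (rpow L (r - 2 * r2) - b * d * q * t1) * (rpow L (r - 2 * r3) - q / t1)) /
      ((rpow L (2 * r1) - b * q) * (rpow L (2 * r1) - d * q) * (rpow L (2 * r2) - e * q) *
       (rpow L (2 * r3) - b * t1^2 * d * e * q)))
     - 1 / t2 * (\<Sum>k<n.
      D_prod [y * t2 * rpow L ((s3 - s2) * real k), u * t2 * rpow L ((s2 + s3 - 2 * s1) * real k),
              w * t2 * rpow L ((s3 - s2) * real k), y * w * u * t2 * rpow L (s * real k + 2)] *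
      rpow L ((s - 2 * s3) * real k + 1) *
      ((qpochs [y * q, w * q] (rpow L (2 * s1)) (int k) * qpoch (u * q) (rpow L (2 * s2)) (int k) *
       qpoch (y * t2^2 * w * u * q) (rpow L (2 * s3)) (int k)) /
      (qpochs [w * u * q * t2, y * u * q * t2] (rpow L (s - 2 * s1)) (int k + 1) *
       qpoch (y * w * q * t2) (rpow L (s - 2 * s2)) (int k + 1) * qpoch (q / t2) (rpow L (s - 2 * s3)) (int k + 1))) *
      ((qpochs [b * q, d * q] (rpow L (2 * r1)) (int k) * qpoch (e * q) (rpow L (2 * r2)) (int k) *
       qpoch (b * d * e * t1^2 * q) (rpow L (2 * r3)) (int k)) /
      (qpochs [d * e * q * t1, b * e * q * t1] (rpow L (r - 2 * r1)) (int k) *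
       qpoch (b * d * q * t1) (rpow L (r - 2 * r2)) (int k) * qpoch (q / t1) (rpow L (r - 2 * r3)) (int k))))"
proof -
  note q = log_q [symmetric]
  define F where "F = (\<lambda>m. qnum L b d e t1 r1 r2 r3 m / qden L b d e t1 r1 r2 r3 m)"
  \<comment> \<open>The roles of \<open>b, d, e\<close> are taken by \<open>y, w, u\<close> in this
    order: \<open>u\<close> belongs to the base with exponent \<open>2 * s2\<close>.\<close>
  define G where "G = (\<lambda>m. qnum L y w u t2 s1 s2 s3 m / qden L y w u t2 s1 s2 s3 m)"
  have G0: "G 0 = 1"
    by (simp add: G_def)
  have F_fold: "qnum L b d e t1 r1 r2 r3 m / qden L b d e t1 r1 r2 r3 m = F m"
    and G_fold: "qnum L y w u t2 s1 s2 s3 m / qden L y w u t2 s1 s2 s3 m = G m" for m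
    by (simp_all add: F_def G_def)
  have num1: "qpochs [b * q, d * q] (rpow L (2 * r1)) m * qpoch (e * q) (rpow L (2 * r2)) m *
      qpoch (b * d * e * t1^2 * q) (rpow L (2 * r3)) m = qnum L b d e t1 r1 r2 r3 m" for m
    by (simp add: qnum_def log_q)
  have num1': "qpochs [b * q, d * q] (rpow L (2 * r1)) m * qpoch (e * q) (rpow L (2 * r2)) m *
      qpoch (b * t1^2 * d * e * q) (rpow L (2 * r3)) m = qnum L b d e t1 r1 r2 r3 m" for m
    by (simp add: qnum_def log_q mult_ac)
  have num2: "qpochs [y * q, w * q] (rpow L (2 * s1)) m * qpoch (u * q) (rpow L (2 * s2)) m *
      qpoch (y * t2^2 * w * u * q) (rpow L (2 * s3)) m = qnum L y w u t2 s1 s2 s3 m" for m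
    by (simp add: qnum_def log_q mult_ac)
  have den1: "qpochs [d * e * q * t1, b * e * q * t1] (rpow L (r - 2 * r1)) m *
      qpoch (b * d * q * t1) (rpow L (r - 2 * r2)) m * qpoch (q / t1) (rpow L (r - 2 * r3)) m
      = qden L b d e t1 r1 r2 r3 m" for m
    by (simp add: qden_def log_q r)
  have den2: "qpochs [w * u * q * t2, y * u * q * t2] (rpow L (s - 2 * s1)) m *
      qpoch (y * w * q * t2) (rpow L (s - 2 * s2)) m * qpoch (q / t2) (rpow L (s - 2 * s3)) m
      = qden L y w u t2 s1 s2 s3 m" for m
    by (simp add: qden_def log_q s)
  note start = den_rhs2 [unfolded q]
  \<comment> \<open>\<open>Z\<close> stands for the quotient of the other family, which multiplies
    the difference in each summand.\<close>
  have F_step: "1 / t1 * (D_prod [e * t1 * rpow L ((r2 + r3 - 2 * r1) * (real k - 1)),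
        b * t1 * rpow L ((r3 - r2) * (real k - 1)), d * t1 * rpow L ((r3 - r2) * (real k - 1)),
        b * d * e * t1 * rpow L (r * (real k - 1) + 2)] *
      rpow L ((r - 2 * r3) * (real k - 1) + 1) *
      (qnum L b d e t1 r1 r2 r3 (int k - 1) / qden L b d e t1 r1 r2 r3 (int k)) * Z)
      = (F (int k) - F (int k - 1)) * Z" if "k \<in> {..<n}" for k Z
  proof -
    have "qden L b d e t1 r1 r2 r3 (int k - 1 + 1) \<noteq> 0"
      using den_sums(1) that by (simp add: den1)
    from quotient_difference [OF _ nonzero(8) this start] show ?thesis
      by (simp add: F_def r)
  qed
  have G_step: "1 / t2 * (D_prod [y * t2 * rpow L ((s3 - s2) * real k),
        u * t2 * rpow L ((s2 + s3 - 2 * s1) * real k), w * t2 * rpow L ((s3 - s2) * real k),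
        y * w * u * t2 * rpow L (s * real k + 2)] *
      rpow L ((s - 2 * s3) * real k + 1) *
      (qnum L y w u t2 s1 s2 s3 (int k) / qden L y w u t2 s1 s2 s3 (int k + 1)) * Z)
      = (G (int k + 1) - G (int k)) * Z" if "k \<in> {..<n}" for k Z
  proof -
    have "qden L y w u t2 s1 s2 s3 (int k + 1) \<noteq> 0"
      using den_sum2 that by (simp add: den2)
    \<comment> \<open>The condition for \<open>m = -1\<close> is vacuous here, as
      \<open>int k\<close> is nonnegative. Unfolding \<open>D_prod\<close> absorbs the different
      order of its arguments.\<close>
    from quotient_difference [OF _ nonzero(9) this] show ?thesis
      by (simp add: G_def s D_prod_def mult_ac)
  qed
  have F_minus1: "((rpow L (r - 2 * r1) - d * e * q * t1) * (rpow L (r - 2 * r1) - b * e * q * t1) *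
       (rpow L (r - 2 * r2) - b * d * q * t1) * (rpow L (r - 2 * r3) - q / t1)) /
      ((rpow L (2 * r1) - b * q) * (rpow L (2 * r1) - d * q) * (rpow L (2 * r2) - e * q) *
       (rpow L (2 * r3) - b * t1^2 * d * e * q)) = F (-1)"
    using quotient_start [OF start] by (simp only: F_def r log_q)
  show ?thesis
    unfolding num1 num1' num2 den1 den2 sum_distrib_left F_minus1 F_fold G_fold
    \<comment> \<open>In the first sum \<open>Z\<close> becomes \<open>G (int k)\<close>, in the
      second \<open>F (int k)\<close>; the lower boundary term is \<open>F (-1)\<close> because
      \<open>G 0 = 1\<close>.\<close>
    by (subst sum.cong [OF refl F_step], assumption, subst sum.cong [OF refl G_step], assumption)
      (simp only: sum_by_parts_int G0 mult_1_right)
qed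

end
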